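(* Let $G$ be a finite simple undirected graph of order $n \geq 3$ with matching number $m$ and connectivity $\kappa$, where $\kappa \geq 2$. If $m \leq \kappa$, then $G$ is Hamiltonian or $G \in \mathcal{F}$, where $\mathcal{F} := \{\, G : K_{p,q} \subseteq G \subseteq K_p \vee (qK_1), \text{ where } q \geq p+1 \geq 3 \,\}$.
   Context: All graphs are finite, undirected, without loops or multiple edges. A matching in $G$ is a set of pairwise non-adjacent edges; the matching number $m(G)$ is the number of edges in a largest matching of $G$. The connectivity $\kappa$ of $G$ is the usual vertex connectivity (with $\kappa(K_n) = n-1$). A graph is Hamiltonian if it has a cycle containing all of its vertices. $G_1 \vee G_2$ denotes the join of two disjoint graphs $G_1$ and $G_2$ (their disjoint union together with all edges between $V(G_1)$ and $V(G_2)$). $K_p$ is the complete graph on $p$ vertices, $qK_1$ is the edgeless graph on $q$ vertices, and $K_{p,q}$ is the complete bipartite graph with parts of sizes $p$ and $q$. The relation $\subseteq$ is the subgraph relation, and graphs are considered up to isomorphism. Thus $G \in \mathcal{F}$ means that there are integers $p, q$ with $q \geq p+1 \geq 3$ and a partition $V(G) = A \sqcup B$ with $|A| = p$, $|B| = q$, such that $B$ is an independent set and every vertex of $A$ is adjacent to every vertex of $B$ (edges inside $A$ are arbitrary). *)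

theory Defs
  imports "Graph_Theory.Graph_Theory"
begin

text \<open>
  A simple graph is a symmetric loop-free digraph without parallel arcs (\<^locale>\<open>pair_graph\<close>);
  an undirected edge is a pair of antiparallel arcs. The edge set below forgets the orientation,
  so that matchings are counted by edges and not by arcs.
\<close>

definition edges_of :: "'a pair_pre_digraph \<Rightarrow> 'a set set" where
  "edges_of G = {{u, v} | u v. (u, v) \<in> parcs G}"

definition matching :: "'a pair_pre_digraph \<Rightarrow> 'a set set \<Rightarrow> bool" where
  "matching G M \<longleftrightarrow> M \<subseteq> edges_of G \<and> pairwise disjnt M"

definition matching_number :: "'a pair_pre_digraph \<Rightarrow> nat" where
  "matching_number G = Max {card M | M. matching G M}"

text \<open>
  The least number of vertices whose deletion leaves a disconnected graph or a single vertex. The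
  second alternative gives the value \<open>n - 1\<close> for the complete graph on \<open>n\<close> vertices. The library's
  \<^const>\<open>connected\<close> is false for the null graph; this does not affect the minimum for nonempty \<open>G\<close>,
  because deleting all but one vertex is already allowed.
\<close>

definition connectivity :: "'a pair_pre_digraph \<Rightarrow> nat" where
  "connectivity G = (LEAST k. \<exists>S \<subseteq> pverts G. card S = k \<and>
     (\<not> connected (with_proj G \<restriction> (pverts G - S)) \<or> card (pverts G - S) = 1))"

text \<open>
  The library's cycles include the closed walk \<open>a, b, a\<close> along a single undirected edge, which the
  length condition rules out. The vertices of a cycle are the tails of its arcs.
\<close>

definition hamiltonian :: "'a pair_pre_digraph \<Rightarrow> bool" where
  "hamiltonian G \<longleftrightarrow>
     (\<exists>p. pre_digraph.cycle (with_proj G) p \<and> 3 \<le> length p \<and> fst ` set p = pverts G)"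

definition complete_on :: "'a set \<Rightarrow> 'a pair_pre_digraph" where
  "complete_on A = \<lparr> pverts = A, parcs = {(u, v). u \<in> A \<and> v \<in> A \<and> u \<noteq> v} \<rparr>"

definition edgeless_on :: "'a set \<Rightarrow> 'a pair_pre_digraph" where
  "edgeless_on B = \<lparr> pverts = B, parcs = {} \<rparr>"

definition complete_bipartite_on :: "'a set \<Rightarrow> 'a set \<Rightarrow> 'a pair_pre_digraph" where
  "complete_bipartite_on A B = \<lparr> pverts = A \<union> B, parcs = A \<times> B \<union> B \<times> A \<rparr>"

definition join :: "'a pair_pre_digraph \<Rightarrow> 'a pair_pre_digraph \<Rightarrow> 'a pair_pre_digraph" where
  "join G H = \<lparr> pverts = pverts G \<union> pverts H,
     parcs = parcs G \<union> parcs H \<union> pverts G \<times> pverts H \<union> pverts H \<times> pverts G \<rparr>"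

text \<open>
  The graphs \<open>G\<close> with \<open>K\<^bsub>p,q\<^esub> \<subseteq> G \<subseteq> K\<^sub>p \<or> qK\<^sub>1\<close> for some \<open>q \<ge> p + 1 \<ge> 3\<close>. Working up to isomorphism
  means that the two bounding graphs may be placed on any two disjoint vertex sets of sizes \<open>p\<close> and
  \<open>q\<close>, the same two sets for both.
\<close>

definition family_F :: "'a pair_pre_digraph set" where
  "family_F = {G. \<exists>p q A B. q \<ge> p + 1 \<and> p + 1 \<ge> 3 \<and>
     card A = p \<and> card B = q \<and> A \<inter> B = {} \<and>
     subgraph (with_proj (complete_bipartite_on A B)) (with_proj G) \<and>
     subgraph (with_proj G) (with_proj (join (complete_on A) (edgeless_on B)))}"

lemma complete_on_complete:
  "finite A \<Longrightarrow> K\<^bsub>card A\<^esub> (with_proj (complete_on A))"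
  by (auto simp: complete_digraph_pair_def complete_on_def)

lemma complete_bipartite_on_complete_bipartite:
  assumes "finite A" "finite B" "A \<inter> B = {}"
  shows "K\<^bsub>card A,card B\<^esub> (with_proj (complete_bipartite_on A B))"
  unfolding complete_bipartite_digraph_pair_def
proof (intro conjI)
  show "\<exists>U V. pverts (complete_bipartite_on A B) = U \<union> V \<and> U \<inter> V = {} \<and>
      card U = card A \<and> card V = card B \<and>
      parcs (complete_bipartite_on A B) = U \<times> V \<union> V \<times> U"
    using assms by (intro exI[of _ A] exI[of _ B]) (simp add: complete_bipartite_on_def)
qed (use assms in \<open>simp_all add: complete_bipartite_on_def\<close>)

lemma family_F_iff_partition:
  assumes "pair_graph G"
  shows "G \<in> family_F \<longleftrightarrow>
    (\<exists>p q A B. q \<ge> p + 1 \<and> p + 1 \<ge> 3 \<and> card A = p \<and> card B = q \<and>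
       A \<inter> B = {} \<and> pverts G = A \<union> B \<and>
       (\<forall>u\<in>B. \<forall>v\<in>B. (u, v) \<notin> parcs G) \<and> (\<forall>a\<in>A. \<forall>b\<in>B. (a, b) \<in> parcs G))"
proof -
  interpret pair_graph G by fact
  have sym: "(v, u) \<in> parcs G" if "(u, v) \<in> parcs G" for u v
    using pair_sym_arcs that by (simp add: symmetric_def sym_def)
  have eq: "subgraph (with_proj (complete_bipartite_on A B)) (with_proj G) \<and>
      subgraph (with_proj G) (with_proj (join (complete_on A) (edgeless_on B))) \<longleftrightarrow>
      pverts G = A \<union> B \<and>
      (\<forall>u\<in>B. \<forall>v\<in>B. (u, v) \<notin> parcs G) \<and> (\<forall>a\<in>A. \<forall>b\<in>B. (a, b) \<in> parcs G)"
    (is "?L \<longleftrightarrow> ?R") if disj: "A \<inter> B = {}" for A B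
  proof -
    have wf: "wf_digraph (with_proj (complete_bipartite_on A B))"
        "wf_digraph (with_proj (join (complete_on A) (edgeless_on B)))"
      by (auto simp: wf_digraph_def complete_bipartite_on_def join_def complete_on_def
          edgeless_on_def)
    have "?L \<longleftrightarrow> A \<union> B \<subseteq> pverts G \<and> pverts G \<subseteq> A \<union> B \<and>
        parcs (complete_bipartite_on A B) \<subseteq> parcs G \<and>
        parcs G \<subseteq> parcs (join (complete_on A) (edgeless_on B))"
      using wf wf_digraph
      by (auto simp: subgraph_def compatible_def complete_bipartite_on_def join_def
          complete_on_def edgeless_on_def)
    also have "\<dots> \<longleftrightarrow> pverts G = A \<union> B \<and>
        parcs (complete_bipartite_on A B) \<subseteq> parcs G \<and>
        parcs G \<subseteq> parcs (join (complete_on A) (edgeless_on B))"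
      by blast
    also have "parcs (complete_bipartite_on A B) \<subseteq> parcs G \<longleftrightarrow>
        (\<forall>a\<in>A. \<forall>b\<in>B. (a, b) \<in> parcs G)"
      using sym unfolding complete_bipartite_on_def by auto
    also have "(pverts G = A \<union> B \<and> (\<forall>a\<in>A. \<forall>b\<in>B. (a, b) \<in> parcs G) \<and>
        parcs G \<subseteq> parcs (join (complete_on A) (edgeless_on B))) \<longleftrightarrow> ?R"
    proof -
      have "parcs G \<subseteq> parcs (join (complete_on A) (edgeless_on B)) \<longleftrightarrow>
          (\<forall>u\<in>B. \<forall>v\<in>B. (u, v) \<notin> parcs G)" if V: "pverts G = A \<union> B"
      proof
        assume "parcs G \<subseteq> parcs (join (complete_on A) (edgeless_on B))"
        then show "\<forall>u\<in>B. \<forall>v\<in>B. (u, v) \<notin> parcs G"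
          using disj by (auto simp: join_def complete_on_def edgeless_on_def)
      next
        assume indep: "\<forall>u\<in>B. \<forall>v\<in>B. (u, v) \<notin> parcs G"
        show "parcs G \<subseteq> parcs (join (complete_on A) (edgeless_on B))"
        proof (rule subrelI)
          fix u v assume e: "(u, v) \<in> parcs G"
          have "u \<in> A \<union> B" "v \<in> A \<union> B" "u \<noteq> v" "\<not> (u \<in> B \<and> v \<in> B)"
            using e in_arcsD1[OF e] in_arcsD2[OF e] pair_no_loops[OF e] V indep by auto
          then show "(u, v) \<in> parcs (join (complete_on A) (edgeless_on B))"
            by (simp add: join_def complete_on_def edgeless_on_def) blast
        qed
      qed
      then show ?thesis by blast
    qed
    finally show ?thesis .
  qed
  show ?thesis
    unfolding family_F_def mem_Collect_eq using eq by (simp cong: conj_cong)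
qed

end

theory Submission
  imports Defs
begin

text \<open>
  Let \<open>k\<close> be the connectivity and \<open>m\<close> the matching number. Every degree is at least \<open>k\<close>, because
  deleting the neighbours of a vertex isolates it. A path on \<open>L\<close> vertices contains a matching of
  \<open>L div 2\<close> edges, so \<open>m \<le> k\<close> forces \<open>L \<le> 2k + 1\<close>. The degrees are thus large compared with the
  longest paths, and Dirac's endpoint argument is almost enough to close a longest path to a cycle;
  what remains is to read off the structure of the tight cases.

  Let \<open>x\<^sub>0 \<dots> x\<^sub>l\<close> be a longest path in a graph that is not Hamiltonian. All neighbours of \<open>x\<^sub>0\<close> and of
  \<open>x\<^sub>l\<close> lie on it. If \<open>x\<^sub>0 x\<^sub>i\<^sub>+\<^sub>1\<close> and \<open>x\<^sub>l x\<^sub>i\<close> are both edges, the path closes to a cycle on the same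
  vertices; this cycle is spanning, since otherwise an edge leaving it would give a longer path.
  So the sets \<open>I = {i. x\<^sub>0 x\<^sub>i\<^sub>+\<^sub>1 is an edge}\<close> and \<open>J = {i. x\<^sub>l x\<^sub>i is an edge}\<close> are disjoint subsets of
  \<open>{0..<l}\<close>, each of size at least \<open>k\<close>, while \<open>l \<le> 2k\<close>: hence \<open>l = 2k\<close> and the two sets
  partition \<open>{0..<2k}\<close>. There are two cases.

  \<^item> The neighbourhood of \<open>x\<^sub>0\<close> has a gap: \<open>i \<notin> I\<close> and \<open>i + 1 \<in> I\<close>. Then \<open>i \<in> J\<close>, and the
    chords \<open>x\<^sub>0 x\<^sub>i\<^sub>+\<^sub>2\<close> and \<open>x\<^sub>l x\<^sub>i\<close> give a cycle on all of the path except \<open>x\<^sub>i\<^sub>+\<^sub>1\<close>. It has \<open>2k\<close> vertices, and the lemma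
    \<open>in_family_F_if_cycle_of_twice_connectivity\<close> shows that the graph is in the family. A vertex
    \<open>x\<close> off the cycle has at least \<open>k\<close> neighbours, all on the cycle because of the matching number,
    and no two of them consecutive because no cycle has \<open>2k + 1\<close> vertices. So \<open>x\<close> is adjacent to
    exactly every other vertex of the cycle, and exchange arguments show that all vertices outside
    \<open>A = N(x)\<close> have the neighbourhood \<open>A\<close>.

  \<^item> There is no gap, so \<open>N(x\<^sub>0) = {x\<^sub>1, \<dots>, x\<^sub>k}\<close>. Reversing an initial segment of the path makes any
    of \<open>x\<^sub>0, \<dots>, x\<^sub>k\<^sub>-\<^sub>1\<close> the first vertex of a longest path, so all of them have their neighbours in
    \<open>{x\<^sub>0, \<dots>, x\<^sub>k}\<close>. Then deleting \<open>x\<^sub>k\<close> separates them from \<open>x\<^sub>2\<^sub>k\<close>, contradicting \<open>k \<ge> 2\<close>.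
\<close>

section \<open>Paths and cycles as vertex lists\<close>

definition path_in :: "'a pair_pre_digraph \<Rightarrow> 'a list \<Rightarrow> bool" where
  "path_in G xs \<longleftrightarrow>
     distinct xs \<and> set xs \<subseteq> pverts G \<and> successively (\<lambda>u v. (u, v) \<in> parcs G) xs"

definition cycle_in :: "'a pair_pre_digraph \<Rightarrow> 'a list \<Rightarrow> bool" where
  "cycle_in G cs \<longleftrightarrow> path_in G cs \<and> 3 \<le> length cs \<and> (last cs, hd cs) \<in> parcs G"

definition neighbours :: "'a pair_pre_digraph \<Rightarrow> 'a \<Rightarrow> 'a set" where
  "neighbours G v = {u. (v, u) \<in> parcs G}"

text \<open>
  The arcs of a closed tour, including the one from the last vertex back to the first. Rotating
  the vertex list only rotates this list, so statements about arcs of a cycle do not depend on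
  where the cycle is cut open.
\<close>

definition cycle_arcs :: "'a list \<Rightarrow> ('a \<times> 'a) list" where
  "cycle_arcs cs = zip cs (rotate1 cs)"

lemma length_cycle_arcs [simp]: "length (cycle_arcs cs) = length cs"
  by (simp add: cycle_arcs_def)

lemma map_fst_cycle_arcs [simp]: "map fst (cycle_arcs cs) = cs"
  by (simp add: cycle_arcs_def)

lemma map_snd_cycle_arcs [simp]: "map snd (cycle_arcs cs) = rotate1 cs"
  by (simp add: cycle_arcs_def)

lemma zip_rotate:
  assumes "length xs = length ys"
  shows "zip (rotate n xs) (rotate n ys) = rotate n (zip xs ys)"
  using assms by (simp add: rotate_drop_take take_zip drop_zip)

lemma cycle_arcs_rotate: "cycle_arcs (rotate n cs) = rotate n (cycle_arcs cs)"
  by (simp add: cycle_arcs_def rotate1_rotate_swap zip_rotate)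

lemma closed_successively_iff_cycle_arcs:
  assumes "cs \<noteq> []"
  shows "successively P cs \<and> P (last cs) (hd cs) \<longleftrightarrow> (\<forall>(u, v) \<in> set (cycle_arcs cs). P u v)"
proof -
  have "successively P (x # ys) \<and> P (last (x # ys)) z \<longleftrightarrow>
      (\<forall>(u, v) \<in> set (zip (x # ys) (ys @ [z])). P u v)" for x ys z
    by (induction ys arbitrary: x) auto
  then show ?thesis using assms by (cases cs) (auto simp: cycle_arcs_def)
qed

lemma last_take_Suc: "i < length xs \<Longrightarrow> last (take (Suc i) xs) = xs ! i"
  by (simp add: take_Suc_conv_app_nth)

lemma cycle_arc_split:
  assumes "(a, b) \<in> set (cycle_arcs cs)"
  obtains "a = last cs" "b = hd cs"
  | as bs where "cs = as @ bs" "as \<noteq> []" "bs \<noteq> []" "last as = a" "hd bs = b"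
proof -
  obtain i where i: "i < length cs" "cs ! i = a" "rotate1 cs ! i = b"
    using assms by (auto simp: cycle_arcs_def in_set_zip)
  show thesis
  proof (cases "Suc i = length cs")
    case True
    then have "cs \<noteq> []" "i = length cs - 1" by auto
    with True i show thesis
      by (intro that(1)) (auto simp: nth_rotate1 last_conv_nth hd_conv_nth)
  next
    case False
    with i have "Suc i < length cs" by simp
    with i show thesis
      by (intro that(2)[of "take (Suc i) cs" "drop (Suc i) cs"])
        (auto simp: nth_rotate1 hd_drop_conv_nth last_take_Suc)
  qed
qed

text \<open>Cutting a cycle open at any of its arcs gives a path from the head to the tail of that arc.\<close>

lemma cycle_arc_rotate_to_ends:
  assumes "(a, b) \<in> set (cycle_arcs cs)"
  obtains n where "last (rotate n cs) = a" "hd (rotate n cs) = b"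
proof (rule cycle_arc_split[OF assms])
  assume "a = last cs" "b = hd cs"
  then show thesis using that[of 0] by simp
next
  fix as bs assume *: "cs = as @ bs" "as \<noteq> []" "bs \<noteq> []" "last as = a" "hd bs = b"
  then show thesis using that[of "length as"] by (simp add: rotate_append)
qed

lemma length_le_card_if_path_in:
  assumes "path_in G xs" "finite (pverts G)"
  shows "length xs \<le> card (pverts G)"
  using assms unfolding path_in_def by (metis card_mono distinct_card)

context pair_graph
begin

lemma adj_sym: "(u, v) \<in> parcs G \<Longrightarrow> (v, u) \<in> parcs G"
  using pair_sym_arcs by (simp add: symmetric_def sym_def)

lemma adj_sym_iff: "(u, v) \<in> parcs G \<longleftrightarrow> (v, u) \<in> parcs G"
  using adj_sym by blast

lemma neighbours_subset: "neighbours G v \<subseteq> pverts G"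
  by (auto simp: neighbours_def dest: in_arcsD2)

lemma path_in_rev: "path_in G (rev xs) \<longleftrightarrow> path_in G xs"
  by (simp add: path_in_def adj_sym_iff)

lemma path_in_append:
  "path_in G (xs @ ys) \<longleftrightarrow> path_in G xs \<and> path_in G ys \<and> set xs \<inter> set ys = {} \<and>
     (xs = [] \<or> ys = [] \<or> (last xs, hd ys) \<in> parcs G)"
  by (auto simp: path_in_def successively_append_iff)

lemma path_in_Cons:
  "path_in G (x # xs) \<longleftrightarrow> x \<in> pverts G \<and> path_in G xs \<and> x \<notin> set xs \<and>
     (xs = [] \<or> (x, hd xs) \<in> parcs G)"
  by (auto simp: path_in_def successively_Cons)

lemma cycle_in_iff_cycle_arcs:
  "cycle_in G cs \<longleftrightarrow> distinct cs \<and> 3 \<le> length cs \<and> set (cycle_arcs cs) \<subseteq> parcs G"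
proof -
  have "set cs \<subseteq> pverts G" if "set (cycle_arcs cs) \<subseteq> parcs G"
  proof -
    have "set cs = fst ` set (cycle_arcs cs)"
      by (metis map_fst_cycle_arcs set_map)
    then show ?thesis using that by (auto dest!: subsetD in_arcsD1)
  qed
  moreover have "successively (\<lambda>u v. (u, v) \<in> parcs G) cs \<and> (last cs, hd cs) \<in> parcs G \<longleftrightarrow>
      set (cycle_arcs cs) \<subseteq> parcs G" if "3 \<le> length cs"
  proof -
    have "cs \<noteq> []" using that by auto
    from closed_successively_iff_cycle_arcs[OF this, of "\<lambda>u v. (u, v) \<in> parcs G"]
    show ?thesis by auto
  qed
  ultimately show ?thesis unfolding cycle_in_def path_in_def by blast
qed

lemma cycle_in_rotate: "cycle_in G cs \<Longrightarrow> cycle_in G (rotate n cs)"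
  by (simp add: cycle_in_iff_cycle_arcs cycle_arcs_rotate)

lemma hamiltonian_if_spanning_cycle:
  assumes "cycle_in G cs" "set cs = pverts G"
  shows "hamiltonian G"
proof -
  have walk: "pre_digraph.cas (with_proj G) x (zip (x # ys) (ys @ [z])) z \<and>
      pre_digraph.awalk_verts (with_proj G) x (zip (x # ys) (ys @ [z])) = (x # ys) @ [z]" for x ys z
    by (induction ys arbitrary: x) auto
  obtain x ys where cs: "cs = x # ys"
    using assms(1) by (cases cs) (auto simp: cycle_in_def)
  have "x \<in> pverts G" "set (cycle_arcs cs) \<subseteq> parcs G" "distinct cs" "3 \<le> length cs"
    using assms cs by (auto simp: cycle_in_iff_cycle_arcs)
  with walk[of x ys x] cs have "pre_digraph.cycle (with_proj G) (cycle_arcs cs)"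
    unfolding pre_digraph.cycle_def pre_digraph.awalk_def cycle_arcs_def
    by (intro exI[of _ x]) auto
  moreover have "fst ` set (cycle_arcs cs) = pverts G"
    using assms(2) by (metis map_fst_cycle_arcs set_map)
  ultimately show ?thesis
    using \<open>3 \<le> length cs\<close> unfolding hamiltonian_def by (metis length_cycle_arcs)
qed

section \<open>Matchings and connectivity\<close>

lemma finite_edges_of: "finite (edges_of G)"
  by (rule finite_subset[of _ "Pow (pverts G)"])
    (auto simp: edges_of_def dest: in_arcsD1 in_arcsD2)

lemma card_matching_le:
  assumes "matching G M"
  shows "card M \<le> matching_number G"
proof -
  have "finite {M. matching G M}"
    by (rule finite_subset[of _ "Pow (edges_of G)"]) (auto simp: matching_def finite_edges_of)
  then have "finite {card M | M. matching G M}" by simp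
  then show ?thesis
    using assms unfolding matching_number_def by (intro Max_ge) auto
qed

lemma matching_insert:
  assumes "matching G M" "(u, v) \<in> parcs G" "u \<notin> \<Union>M" "v \<notin> \<Union>M"
  shows "matching G (insert {u, v} M)" and "card (insert {u, v} M) = Suc (card M)"
proof -
  have "\<forall>e\<in>M. disjnt {u, v} e" and "{u, v} \<notin> M"
    using assms(3,4) by (auto simp: disjnt_def)
  moreover have "finite M"
    using assms(1) finite_edges_of by (auto simp: matching_def elim: finite_subset)
  ultimately show "matching G (insert {u, v} M)" "card (insert {u, v} M) = Suc (card M)"
    using assms(1,2) unfolding matching_def edges_of_def
    by (auto simp: pairwise_insert disjnt_sym)
qed

text \<open>Every other edge of a path is in the matching.\<close>

lemma matching_of_path:
  assumes "path_in G xs"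
  shows "\<exists>M. matching G M \<and> \<Union>M \<subseteq> set xs \<and> card M = length xs div 2"
  using assms
proof (induction xs rule: induct_list012)
  case (3 x y zs)
  then have zs: "path_in G zs" and xy: "(x, y) \<in> parcs G" "x \<notin> set zs" "y \<notin> set zs"
    by (auto simp: path_in_Cons)
  with 3 obtain M where M: "matching G M" "\<Union>M \<subseteq> set zs" "card M = length zs div 2"
    by auto
  then have "x \<notin> \<Union>M" "y \<notin> \<Union>M" using xy by auto
  from matching_insert[OF M(1) xy(1) this] M show ?case
    by (intro exI[of _ "insert {x, y} M"]) auto
qed (auto intro!: exI[of _ "{}"] simp: matching_def)

lemma length_path_le_matching_number:
  assumes "path_in G xs"
  shows "length xs div 2 \<le> matching_number G"
  using matching_of_path[OF assms] card_matching_le by metis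

lemma path_plus_disjoint_edge_le_matching_number:
  assumes "path_in G xs" "(u, v) \<in> parcs G" "u \<notin> set xs" "v \<notin> set xs"
  shows "length xs div 2 + 1 \<le> matching_number G"
proof -
  obtain M where M: "matching G M" "\<Union>M \<subseteq> set xs" "card M = length xs div 2"
    using matching_of_path[OF assms(1)] by blast
  then have "u \<notin> \<Union>M" "v \<notin> \<Union>M" using assms(3,4) by auto
  from matching_insert[OF M(1) assms(2) this] card_matching_le M(3) show ?thesis by fastforce
qed

text \<open>
  Connectedness of the graph without \<open>S\<close>, in the form in which it is used: no proper nonempty part
  \<open>X\<close> of the remaining vertices is closed under adjacency.
\<close>

lemma few_vertices_do_not_separate:
  assumes S: "S \<subseteq> pverts G" "card S < connectivity G"
    and X: "X \<subseteq> pverts G - S" "X \<noteq> {}" "X \<noteq> pverts G - S"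
  shows "\<exists>u v. (u, v) \<in> parcs G \<and> u \<in> X \<and> v \<in> pverts G - S - X"
proof (rule ccontr)
  assume no_arc: "\<not> ?thesis"
  have closed: "v \<in> X" if "(u, v) \<in> parcs G" "u \<in> X" "v \<in> pverts G - S" for u v
    using no_arc that by blast
  let ?H = "with_proj G \<restriction> (pverts G - S)"
  have "connected ?H"
    using not_less_Least[OF S(2)[unfolded connectivity_def]] S(1) by blast
  obtain u v where uv: "u \<in> X" "v \<in> pverts G - S" "v \<notin> X"
    using X by blast
  have "(u, v) \<in> rtrancl_on (verts ?H) ((arcs_ends ?H)\<^sup>s)"
    using \<open>connected ?H\<close> uv X(1) unfolding connected_conv by auto
  then have "v \<in> X"
  proof (induction rule: rtrancl_on_induct)
    case (step y z)
    then have "(y, z) \<in> parcs G" "z \<in> pverts G - S"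
      by (auto simp: symcl_def arcs_ends_conv intro: adj_sym)
    with step closed show ?case by blast
  qed (use uv in auto)
  with uv show False by simp
qed

text \<open>
  Deleting fewer than \<open>connectivity G\<close> vertices cannot isolate \<open>v\<close>, nor can it leave \<open>v\<close> alone,
  which is where complete graphs would otherwise be an exception.
\<close>

lemma connectivity_le_degree:
  assumes "v \<in> pverts G"
  shows "connectivity G \<le> card (neighbours G v)"
proof (rule ccontr)
  assume "\<not> ?thesis"
  then have less: "card (neighbours G v) < connectivity G" by simp
  have v: "v \<notin> neighbours G v" using pair_no_loops[of "(v, v)"] by (auto simp: neighbours_def)
  have "card (pverts G - neighbours G v) \<noteq> 1"
    using not_less_Least[OF less[unfolded connectivity_def]] neighbours_subset by blast
  then have "{v} \<noteq> pverts G - neighbours G v" by (metis card_1_singleton_iff One_nat_def)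
  then obtain w where "(v, w) \<in> parcs G" "w \<in> pverts G - neighbours G v - {v}"
    using few_vertices_do_not_separate[OF neighbours_subset less, of "{v}"] assms v by blast
  then show False by (simp add: neighbours_def)
qed

text \<open>
  An edge leaving a cycle extends the cycle, cut open at that edge, to a path with one more vertex.
\<close>

lemma hamiltonian_if_cycle_as_long_as_paths:
  assumes "cycle_in G cs" "0 < connectivity G"
    and longest: "\<And>ys. path_in G ys \<Longrightarrow> length ys \<le> length cs"
  shows "hamiltonian G"
proof (rule ccontr)
  assume "\<not> ?thesis"
  then have "set cs \<noteq> pverts G - {}"
    using hamiltonian_if_spanning_cycle[OF assms(1)] by auto
  moreover have "set cs \<subseteq> pverts G - {}" "set cs \<noteq> {}"
    using assms(1) by (auto simp: cycle_in_def path_in_def)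
  ultimately obtain c y where cy: "(c, y) \<in> parcs G" "c \<in> set cs" "y \<in> pverts G - {} - set cs"
    using few_vertices_do_not_separate[of "{}" "set cs"] assms(2) by auto
  obtain d where "(c, d) \<in> set (cycle_arcs cs)"
    using cy(2) by (metis (no_types) image_iff list.set_map map_fst_cycle_arcs prod.collapse)
  then obtain n where n: "last (rotate n cs) = c"
    by (rule cycle_arc_rotate_to_ends)
  have "path_in G (rotate n cs @ [y])"
    using cycle_in_rotate[OF assms(1), of n] n cy
    by (auto simp: path_in_append path_in_Cons cycle_in_def) (simp add: path_in_def)
  from longest[OF this] show False by simp
qed

text \<open>
  This closes a path by two crossing chords from its ends, where the two paths are the pieces left
  and right of the crossing and a vertex between them may be left out. It also yields the cycle
  that results from inserting a new vertex into a cycle with the help of one chord.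
\<close>

lemma cycle_from_two_paths:
  assumes "path_in G as" "path_in G bs" "set as \<inter> set bs = {}" "as \<noteq> []" "bs \<noteq> []"
    and "3 \<le> length as + length bs"
    and "(hd as, hd bs) \<in> parcs G" "(last as, last bs) \<in> parcs G"
  shows "cycle_in G (as @ rev bs)"
proof -
  have "(last bs, last as) \<in> parcs G" "(hd bs, hd as) \<in> parcs G"
    using assms(7,8) by (simp_all add: adj_sym)
  then show ?thesis
    using assms(1-6,8) by (simp add: cycle_in_def path_in_append path_in_rev hd_rev last_rev)
qed

section \<open>A cycle of length twice the connectivity\<close>

text \<open>
  Let \<open>A\<close> be the neighbourhood of \<open>x\<close> and let \<open>B\<close> be the set of successors of \<open>A\<close> along the cycle.
  Any edge between two vertices outside \<open>A\<close> produces a path on \<open>2k + 2\<close> vertices, a cycle on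
  \<open>2k + 1\<close> vertices, or a matching of \<open>k + 1\<close> edges. The first and the last exceed the matching
  number, and the cycle would be as long as any path and hence spanning. So the complement of
  \<open>A\<close> is independent; the degree bound then makes every vertex in it adjacent to all of \<open>A\<close>.
\<close>

lemma in_family_F_if_cycle_of_twice_connectivity:
  assumes cyc: "cycle_in G cs" and len: "length cs = 2 * connectivity G"
    and conn: "2 \<le> connectivity G" and mat: "matching_number G \<le> connectivity G"
    and x: "x \<in> pverts G" "x \<notin> set cs" and nonham: "\<not> hamiltonian G"
  shows "G \<in> family_F"
proof -
  let ?k = "connectivity G"
  have short: "length ys \<le> 2 * ?k + 1" if "path_in G ys" for ys
    using length_path_le_matching_number[OF that] mat by linarith
  have no_cycle: False if "cycle_in G ys" "length ys = 2 * ?k + 1" for ys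
    using hamiltonian_if_cycle_as_long_as_paths[OF that(1)] short that(2) conn nonham by auto
  have nbr_out: "z \<in> set cs" if "(y, z) \<in> parcs G" "y \<notin> set cs" for y z
  proof (rule ccontr)
    assume "z \<notin> set cs"
    moreover have "path_in G cs" using cyc by (simp add: cycle_in_def)
    ultimately show False
      using path_plus_disjoint_edge_le_matching_number[of cs y z] that len mat by simp
  qed
  \<comment> \<open>Between the ends of an arc \<open>ab\<close> one can insert one outside vertex adjacent to both, which gives
    a longer cycle, or append different outside neighbours at the two ends of the opened cycle.\<close>
  have hop: False
    if ab: "(a, b) \<in> set (cycle_arcs cs)" and yz: "(y, a) \<in> parcs G" "(z, b) \<in> parcs G"
      "y \<notin> set cs" "z \<notin> set cs" for a b y z
  proof -
    obtain n where n: "last (rotate n cs) = a" "hd (rotate n cs) = b"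
      using cycle_arc_rotate_to_ends[OF ab] by blast
    define r where "r = rotate n cs"
    have r: "path_in G r" "r \<noteq> []" "last r = a" "hd r = b" "set r = set cs" "length r = 2 * ?k"
      using cycle_in_rotate[OF cyc, of n] n len unfolding r_def
      by (auto simp: cycle_in_def)
    have V: "y \<in> pverts G" "z \<in> pverts G" using yz by (auto dest: in_arcsD1)
    show False
    proof (cases "y = z")
      case True
      have "cycle_in G (z # r)"
        using r yz V True conn adj_sym[OF yz(1)] by (auto simp: cycle_in_def path_in_Cons)
      then show False by (rule no_cycle) (simp add: r(6))
    next
      case False
      have "path_in G [y]" using V(1) by (simp add: path_in_def)
      then have "path_in G (z # r @ [y])"
        using r yz V False adj_sym[OF yz(1)] by (simp add: path_in_Cons path_in_append)
      from short[OF this] r(6) show False by simp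
    qed
  qed
  define A where "A = neighbours G x"
  define P where "P = {p \<in> set (cycle_arcs cs). fst p \<in> A}"
  define B where "B = snd ` P"
  have dist: "distinct cs" using cyc by (simp add: cycle_in_iff_cycle_arcs)
  have A_cs: "A \<subseteq> set cs" using nbr_out x(2) by (auto simp: A_def neighbours_def)
  have B_cs: "B \<subseteq> set cs"
    unfolding B_def P_def by (auto simp: cycle_arcs_def dest: set_zip_rightD)
  have BE: "\<exists>a. (a, b) \<in> set (cycle_arcs cs) \<and> (x, a) \<in> parcs G" if "b \<in> B" for b
    using that by (auto simp: B_def P_def A_def neighbours_def)
  have "card B = card A"
  proof -
    have "distinct (map fst (cycle_arcs cs))" "distinct (map snd (cycle_arcs cs))"
      using dist by simp_all
    then have "inj_on fst (set (cycle_arcs cs))" "inj_on snd (set (cycle_arcs cs))"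
      unfolding distinct_map by blast+
    then have "inj_on fst P" "inj_on snd P"
      unfolding P_def by (auto elim: inj_on_subset)
    moreover have "fst ` P = A"
    proof -
      have "fst ` set (cycle_arcs cs) = set cs" by (metis map_fst_cycle_arcs set_map)
      moreover have "fst ` P = fst ` set (cycle_arcs cs) \<inter> A"
        unfolding P_def by (auto simp: image_iff)
      ultimately show ?thesis using A_cs by auto
    qed
    ultimately show ?thesis unfolding B_def by (metis card_image)
  qed
  have A_B: "A \<inter> B = {}"
  proof (rule ccontr)
    assume "A \<inter> B \<noteq> {}"
    then obtain b where "b \<in> B" "(x, b) \<in> parcs G" by (auto simp: A_def neighbours_def)
    with BE obtain a where "(a, b) \<in> set (cycle_arcs cs)" "(x, a) \<in> parcs G" by metis
    from hop[OF this \<open>(x, b) \<in> parcs G\<close> x(2) x(2)] show False .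
  qed
  have degA: "?k \<le> card A" using connectivity_le_degree[OF x(1)] by (simp add: A_def)
  have fin: "finite A" "finite B" using A_cs B_cs finite_subset by auto
  have card_cs: "card (set cs) = 2 * ?k" using dist len by (simp add: distinct_card)
  \<comment> \<open>\<open>A\<close> and \<open>B\<close> are disjoint, of equal size at least \<open>k\<close>, and fit into \<open>2k\<close> vertices.\<close>
  have "card (A \<union> B) = card A + card B" using A_B fin by (simp add: card_Un_disjoint)
  moreover have "card (A \<union> B) \<le> 2 * ?k"
    using card_mono[of "set cs" "A \<union> B"] A_cs B_cs card_cs by simp
  ultimately have card_A: "card A = ?k" and "card (A \<union> B) = card (set cs)"
    using degA \<open>card B = card A\<close> card_cs by linarith+
  then have cs: "A \<union> B = set cs" using A_cs B_cs by (intro card_subset_eq) auto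
  \<comment> \<open>Opened between \<open>a\<close> and \<open>b\<close>, the cycle is a path \<open>b \<dots> a' b' \<dots> a\<close>. The edges \<open>bb'\<close>, \<open>xa\<close> and \<open>xa'\<close>
    make it a cycle through \<open>x\<close>: \<open>x a' \<dots> b b' \<dots> a x\<close>.\<close>
  have indep: False if b: "b \<in> B" "b' \<in> B" "(b, b') \<in> parcs G" for b b'
  proof -
    obtain a a' where a: "(a, b) \<in> set (cycle_arcs cs)" "(x, a) \<in> parcs G"
      and a': "(a', b') \<in> set (cycle_arcs cs)" "(x, a') \<in> parcs G"
      using BE b by metis
    obtain n where n: "last (rotate n cs) = a" "hd (rotate n cs) = b"
      using cycle_arc_rotate_to_ends[OF a(1)] by blast
    define r where "r = rotate n cs"
    have "cycle_in G r" "set r = set cs" "length r = 2 * ?k"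
      using cycle_in_rotate[OF cyc, of n] len by (simp_all add: r_def)
    then have r: "path_in G r" by (simp add: cycle_in_def)
    have "b' \<noteq> b" using b(3) pair_no_loops[of "(b, b)"] by auto
    have "(a', b') \<in> set (cycle_arcs r)" using a'(1) by (simp add: r_def cycle_arcs_rotate)
    then obtain bs ds where split: "r = bs @ ds" "bs \<noteq> []" "ds \<noteq> []" "last bs = a'" "hd ds = b'"
      by (rule cycle_arc_split) (use n \<open>b' \<noteq> b\<close> r_def in auto)
    have ends: "hd bs = b" "last ds = a" using n split by (auto simp: r_def)
    have "cycle_in G ((x # rev bs) @ rev (rev ds))"
    proof (rule cycle_from_two_paths)
      show "path_in G (x # rev bs)" "path_in G (rev ds)" "set (x # rev bs) \<inter> set (rev ds) = {}"
        using r x split a' \<open>set r = set cs\<close>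
        by (auto simp: path_in_Cons path_in_append path_in_rev hd_rev)
      show "3 \<le> length (x # rev bs) + length (rev ds)"
        using split(1) \<open>length r = 2 * ?k\<close> conn by simp
    qed (use split ends a b in \<open>simp_all add: hd_rev last_rev\<close>)
    then show False
      by (rule no_cycle) (use split(1) \<open>length r = 2 * ?k\<close> in simp)
  qed
  have nbrs: "neighbours G v = A" if v: "v \<in> pverts G - A" for v
  proof (rule card_seteq[OF fin(1)])
    show "neighbours G v \<subseteq> A"
    proof
      fix z assume "z \<in> neighbours G v"
      then have vz: "(v, z) \<in> parcs G" by (simp add: neighbours_def)
      show "z \<in> A"
      proof (cases "v \<in> set cs")
        case True
        then have "v \<in> B" using cs v by blast
        then obtain a where "(a, v) \<in> set (cycle_arcs cs)" "(x, a) \<in> parcs G" using BE by blast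
        then have "z \<in> set cs" using hop[of a v x z] x(2) adj_sym[OF vz] by blast
        then show ?thesis using cs indep \<open>v \<in> B\<close> vz by blast
      next
        case False
        then have "z \<in> set cs" using nbr_out vz by blast
        moreover have "z \<notin> B" using BE hop[of _ z x v] False x(2) vz by blast
        ultimately show ?thesis using cs by blast
      qed
    qed
    show "card A \<le> card (neighbours G v)"
      using connectivity_le_degree[of v] v card_A by simp
  qed
  have "insert x B \<subseteq> pverts G - A"
    using A_B A_cs B_cs cyc x by (auto simp: cycle_in_def path_in_def)
  moreover have "card (insert x B) = ?k + 1"
    using fin B_cs x(2) \<open>card B = card A\<close> card_A by (subst card_insert_disjoint) auto
  ultimately have "?k + 1 \<le> card (pverts G - A)"
    by (metis card_mono finite_Diff pair_finite_verts)
  moreover have "\<forall>u\<in>pverts G - A. \<forall>v\<in>pverts G - A. (u, v) \<notin> parcs G"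
    "\<forall>a\<in>A. \<forall>b\<in>pverts G - A. (a, b) \<in> parcs G"
    using nbrs adj_sym by (auto simp: neighbours_def)
  moreover have "A \<subseteq> pverts G" unfolding A_def by (rule neighbours_subset)
  ultimately show ?thesis
    unfolding family_F_iff_partition[OF pair_graph_axioms]
    using card_A conn
    by (intro exI[of _ ?k] exI[of _ "card (pverts G - A)"] exI[of _ A] exI[of _ "pverts G - A"]) auto
qed

section \<open>The neighbourhood of an end of a longest path\<close>

definition longest_path_in :: "'a list \<Rightarrow> bool" where
  "longest_path_in xs \<longleftrightarrow> path_in G xs \<and> (\<forall>ys. path_in G ys \<longrightarrow> length ys \<le> length xs)"

lemma longest_path_in_rev: "longest_path_in xs \<Longrightarrow> longest_path_in (rev xs)"
  by (simp add: longest_path_in_def path_in_rev)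

lemma longest_path_exists: "\<exists>xs. longest_path_in xs"
  using ex_has_greatest_nat[of "path_in G" "[]" length "Suc (card (pverts G))"]
    length_le_card_if_path_in[OF _ pair_finite_verts]
  by (force simp: longest_path_in_def less_Suc_eq_le path_in_def[of _ "[]"])

lemma neighbours_hd_longest_path:
  assumes "longest_path_in xs" "xs \<noteq> []"
  shows "neighbours G (hd xs) \<subseteq> set (tl xs)"
proof
  fix u assume "u \<in> neighbours G (hd xs)"
  then have u: "(hd xs, u) \<in> parcs G" by (simp add: neighbours_def)
  have "u \<in> set xs"
  proof (rule ccontr)
    assume "u \<notin> set xs"
    with u assms have "path_in G (u # xs)"
      by (auto simp: path_in_Cons longest_path_in_def intro: adj_sym dest: in_arcsD2)
    with assms show False by (auto simp: longest_path_in_def)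
  qed
  moreover have "u \<noteq> hd xs" using u pair_no_loops by fastforce
  ultimately show "u \<in> set (tl xs)" using assms(2) by (cases xs) auto
qed

text \<open>
  A chord \<open>x\<^sub>0 x\<^sub>i\<^sub>+\<^sub>1\<close> is recorded by its index \<open>i\<close> in \<open>I\<close>, shifted by one so that it crosses the chord
  of \<open>x\<^sub>l\<close> with the same index \<open>i\<close> in \<open>J\<close>.
\<close>

lemma neighbours_hd_longest_path_initial:
  assumes xs: "longest_path_in xs" and ne: "pverts G \<noteq> {}"
    and conn: "2 \<le> connectivity G" and mat: "matching_number G \<le> connectivity G"
    and nonham: "\<not> hamiltonian G" and notF: "G \<notin> family_F"
  shows "length xs = 2 * connectivity G + 1"
    and "neighbours G (hd xs) = (\<lambda>i. xs ! Suc i) ` {..<connectivity G}"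
proof -
  let ?k = "connectivity G"
  have path: "path_in G xs" and longest: "\<And>ys. path_in G ys \<Longrightarrow> length ys \<le> length xs"
    using xs by (auto simp: longest_path_in_def)
  have xs_ne: "xs \<noteq> []"
  proof -
    obtain v where "v \<in> pverts G" using ne by blast
    then have "path_in G [v]" by (simp add: path_in_def)
    from longest[OF this] show ?thesis by auto
  qed
  have verts: "set xs \<subseteq> pverts G" using path by (simp add: path_in_def)
  define I where "I = {i. i < length xs - 1 \<and> (hd xs, xs ! Suc i) \<in> parcs G}"
  define J where "J = {i. i < length xs - 1 \<and> (last xs, xs ! i) \<in> parcs G}"
  have fin: "finite I" "finite J" by (auto simp: I_def J_def)
  have nbr_hd: "neighbours G (hd xs) = (\<lambda>i. xs ! Suc i) ` I"
  proof
    show "neighbours G (hd xs) \<subseteq> (\<lambda>i. xs ! Suc i) ` I"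
    proof
      fix u assume u: "u \<in> neighbours G (hd xs)"
      then have "u \<in> set (tl xs)" using neighbours_hd_longest_path[OF xs xs_ne] by blast
      then obtain i where "i < length xs - 1" "u = xs ! Suc i"
        by (auto simp: in_set_conv_nth nth_tl)
      with u show "u \<in> (\<lambda>i. xs ! Suc i) ` I" by (auto simp: I_def neighbours_def)
    qed
  qed (auto simp: I_def neighbours_def)
  have nbr_last: "neighbours G (last xs) \<subseteq> (!) xs ` J"
  proof
    fix u assume u: "u \<in> neighbours G (last xs)"
    then have "u \<in> set (butlast xs)"
      using neighbours_hd_longest_path[OF longest_path_in_rev[OF xs]] xs_ne
      by (auto simp: hd_rev butlast_rev[of "rev xs", simplified])
    then obtain i where "i < length xs - 1" "u = xs ! i"
      by (auto simp: in_set_conv_nth nth_butlast)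
    with u show "u \<in> (!) xs ` J" by (auto simp: J_def neighbours_def)
  qed
  have card_I: "?k \<le> card I"
  proof -
    have "?k \<le> card (neighbours G (hd xs))"
      using verts xs_ne by (intro connectivity_le_degree) auto
    also have "\<dots> \<le> card I" unfolding nbr_hd using fin(1) by (rule card_image_le)
    finally show ?thesis .
  qed
  have card_J: "?k \<le> card J"
  proof -
    have "?k \<le> card (neighbours G (last xs))"
      using verts xs_ne by (intro connectivity_le_degree) auto
    also have "\<dots> \<le> card ((!) xs ` J)" using nbr_last fin(2) by (intro card_mono) auto
    also have "\<dots> \<le> card J" using fin(2) by (rule card_image_le)
    finally show ?thesis .
  qed
  have sub: "I \<subseteq> {..<length xs - 1}" "J \<subseteq> {..<length xs - 1}" by (auto simp: I_def J_def)
  have "3 \<le> length xs"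
    using card_mono[OF _ sub(1)] card_I conn by simp
  have disj: "I \<inter> J = {}"
  proof (rule ccontr)
    assume "I \<inter> J \<noteq> {}"
    then obtain i where i: "i \<in> I" "i \<in> J" by blast
    then have i': "Suc i < length xs" by (auto simp: I_def)
    have "path_in G (take (Suc i) xs @ drop (Suc i) xs)" using path by simp
    then have "cycle_in G (take (Suc i) xs @ rev (drop (Suc i) xs))"
      unfolding path_in_append using i i' \<open>3 \<le> length xs\<close> xs_ne
      by (intro cycle_from_two_paths)
        (auto simp: I_def J_def hd_drop_conv_nth last_take_Suc intro: adj_sym)
    moreover have "length (take (Suc i) xs @ rev (drop (Suc i) xs)) = length xs"
      using i' by simp
    ultimately show False
      using hamiltonian_if_cycle_as_long_as_paths longest conn nonham by (metis not_numeral_le_zero not_gr_zero)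
  qed
  have "card I + card J = card (I \<union> J)" using fin disj by (simp add: card_Un_disjoint)
  moreover have "card (I \<union> J) \<le> length xs - 1"
    using card_mono[of "{..<length xs - 1}" "I \<union> J"] sub by simp
  moreover have "length xs \<le> 2 * ?k + 1"
    using length_path_le_matching_number[OF path] mat by linarith
  ultimately have len: "length xs = 2 * ?k + 1" and "card I = ?k" and "card (I \<union> J) = 2 * ?k"
    using card_I card_J \<open>3 \<le> length xs\<close> by linarith+
  have IJ: "I \<union> J = {..<2 * ?k}"
    using sub len \<open>card (I \<union> J) = 2 * ?k\<close> by (intro card_subset_eq) auto
  \<comment> \<open>At a gap the chords \<open>x\<^sub>0 x\<^sub>i\<^sub>+\<^sub>2\<close> and \<open>x\<^sub>l x\<^sub>i\<close> give a cycle that misses only \<open>x\<^sub>i\<^sub>+\<^sub>1\<close>.\<close>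
  have down: "i \<in> I" if "Suc i \<in> I" for i
  proof (rule ccontr)
    assume "i \<notin> I"
    have i: "Suc (Suc i) < length xs" using that by (auto simp: I_def)
    then have "i \<in> J" using \<open>i \<notin> I\<close> IJ len by (metis Suc_lessD Suc_less_eq Un_iff add.commute lessThan_iff plus_1_eq_Suc)
    have "path_in G (take (Suc i) xs @ drop (Suc i) xs)" using path by simp
    moreover have "drop (Suc i) xs = xs ! Suc i # drop (Suc (Suc i)) xs"
      using i by (simp add: Cons_nth_drop_Suc)
    ultimately have p: "path_in G (take (Suc i) xs @ xs ! Suc i # drop (Suc (Suc i)) xs)" by simp
    let ?cs = "take (Suc i) xs @ rev (drop (Suc (Suc i)) xs)"
    have "cycle_in G ?cs"
      using p that \<open>i \<in> J\<close> i len conn xs_ne unfolding path_in_append path_in_Cons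
      by (intro cycle_from_two_paths)
        (auto simp: I_def J_def hd_drop_conv_nth last_take_Suc intro: adj_sym)
    moreover have "length ?cs = 2 * ?k" using i len by simp
    moreover have "xs ! Suc i \<in> pverts G" "xs ! Suc i \<notin> set ?cs"
      using p by (auto simp: path_in_append path_in_Cons)
    ultimately show False
      using in_family_F_if_cycle_of_twice_connectivity conn mat nonham notF by blast
  qed
  have down': "j \<in> I" if "i \<in> I" "j \<le> i" for i j
    using that(2,1) by (induction rule: inc_induct) (auto intro: down)
  have "I \<subseteq> {..<?k}"
  proof
    fix i assume "i \<in> I"
    then have "{..i} \<subseteq> I" using down' by blast
    then have "card {..i} \<le> card I" using fin(1) by (intro card_mono)
    then show "i \<in> {..<?k}" using \<open>card I = ?k\<close> by simp
  qed
  then have "I = {..<?k}" using \<open>card I = ?k\<close> by (intro card_subset_eq) auto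
  with nbr_hd len show "length xs = 2 * ?k + 1"
    "neighbours G (hd xs) = (\<lambda>i. xs ! Suc i) ` {..<?k}" by auto
qed

text \<open>
  The first \<open>k\<close> vertices of a longest path can all take the place of its first vertex, so the
  description of the neighbourhood of an end applies to each of them.
\<close>

lemma hamiltonian_or_in_family_F:
  assumes ne: "pverts G \<noteq> {}" and conn: "2 \<le> connectivity G"
    and mat: "matching_number G \<le> connectivity G"
  shows "hamiltonian G \<or> G \<in> family_F"
proof (rule ccontr)
  assume "\<not> ?thesis"
  then have neg: "\<not> hamiltonian G" "G \<notin> family_F" by blast+
  let ?k = "connectivity G"
  obtain xs where xs: "longest_path_in xs" using longest_path_exists by blast
  note init = neighbours_hd_longest_path_initial[OF _ ne conn mat neg]
  have len: "length xs = 2 * ?k + 1" using init(1)[OF xs] .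
  have path: "path_in G xs" using xs by (simp add: longest_path_in_def)
  have nbrs: "neighbours G (xs ! i) \<subseteq> (!) xs ` {..?k}" if i: "i < ?k" for i
  proof -
    define ys where "ys = rev (take (Suc i) xs) @ drop (Suc i) xs"
    have "hd xs = xs ! 0" using len by (intro hd_conv_nth) auto
    then have "(xs ! 0, xs ! Suc i) \<in> parcs G"
      using init(2)[OF xs] i by (auto simp: neighbours_def)
    moreover have "path_in G (take (Suc i) xs @ drop (Suc i) xs)" using path by simp
    ultimately have "path_in G ys"
      unfolding ys_def path_in_append path_in_rev using len i \<open>hd xs = xs ! 0\<close>
      by (auto simp: last_rev hd_drop_conv_nth)
    moreover have "length ys = length xs" using len i by (simp add: ys_def)
    ultimately have "longest_path_in ys" using xs by (simp add: longest_path_in_def)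
    from init(2)[OF this] have "neighbours G (hd ys) = (\<lambda>j. ys ! Suc j) ` {..<?k}" .
    moreover have "hd ys = xs ! i"
      using len i by (auto simp: ys_def hd_append hd_rev last_take_Suc)
    moreover have "ys ! j \<in> (!) xs ` {..?k}" if "j \<le> ?k" for j
    proof (cases "j \<le> i")
      case True
      then have "ys ! j = xs ! (i - j)" using len i by (simp add: ys_def nth_append rev_nth)
      then show ?thesis using i by auto
    next
      case False
      then have "ys ! j = xs ! j" using len i that by (simp add: ys_def nth_append)
      then show ?thesis using that by auto
    qed
    ultimately show ?thesis by auto
  qed
  let ?X = "(!) xs ` {..<?k}" and ?S = "{xs ! ?k}"
  have inj: "xs ! i = xs ! j \<longleftrightarrow> i = j" if "i < length xs" "j < length xs" for i j
    using path that by (simp add: path_in_def nth_eq_iff_index_eq)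
  have verts: "xs ! i \<in> pverts G" if "i < length xs" for i
    using path that by (auto simp: path_in_def)
  have "\<exists>u v. (u, v) \<in> parcs G \<and> u \<in> ?X \<and> v \<in> pverts G - ?S - ?X"
  proof (rule few_vertices_do_not_separate)
    show "?S \<subseteq> pverts G" using verts len by simp
    show "card ?S < ?k" using conn by simp
    show "?X \<subseteq> pverts G - ?S" using verts inj len by auto
    show "?X \<noteq> {}" using conn by (auto simp: lessThan_empty_iff)
    have "xs ! (2 * ?k) \<in> pverts G - ?S" "xs ! (2 * ?k) \<notin> ?X"
      using verts inj len conn by auto
    then show "?X \<noteq> pverts G - ?S" by blast
  qed
  then obtain u v where uv: "(u, v) \<in> parcs G" "u \<in> ?X" "v \<notin> ?S" "v \<notin> ?X" by blast
  then obtain i where "i < ?k" "u = xs ! i" by auto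
  then have "v \<in> (!) xs ` {..?k}" using nbrs uv(1) by (auto simp: neighbours_def)
  moreover have "{..?k} = insert ?k {..<?k}" by auto
  ultimately show False using uv(3,4) by auto
qed

end

theorem theorem1:
  fixes G :: "'a pair_pre_digraph"
  assumes "pair_graph G"
    and "card (pverts G) \<ge> 3"
    and "connectivity G \<ge> 2"
    and "matching_number G \<le> connectivity G"
  shows "hamiltonian G \<or> G \<in> family_F"
proof (rule pair_graph.hamiltonian_or_in_family_F)
  show "pverts G \<noteq> {}" using assms(2) by auto
qed (use assms in simp_all)

end
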